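(* Consider the market model with price-sensitive load described in the context, and let $\boldsymbol{\varepsilon}=(\boldsymbol{\varepsilon}_1,\dots,\boldsymbol{\varepsilon}_n)$, $\boldsymbol{\varepsilon}_i\in\mathbb{R}_{>0}^T$ for all $i\in I$, and $\boldsymbol{\rho}=(\boldsymbol{\rho}_1,\dots,\boldsymbol{\rho}_m)$, $\boldsymbol{\rho}_j\in\mathbb{R}_{>0}^T$ for all $j\in J$. Then the primal problem and the modified primal problem have the same set of maximizers and the same optimal value, $U=\tilde U(\boldsymbol{\varepsilon},\boldsymbol{\rho})$, and the duality gaps satisfy $$0\le\tilde U^D(\boldsymbol{\varepsilon},\boldsymbol{\rho})-\tilde U(\boldsymbol{\varepsilon},\boldsymbol{\rho})\le U^D-U .$$ Consequently, the total uplift in the modified problem is no higher than the total uplift in the original problem: for every $\mathbf{p}^+\in P^+$, every $\tilde{\mathbf{p}}^+\in\tilde P^+(\boldsymbol{\varepsilon},\boldsymbol{\rho})$ and every maximizer $(\mathbf{x}^*,\mathbf{y}^* )$ of the primal problem, $$\sum_{j\in J}\bigl[\tilde\pi_j^{cons}(\tilde{\mathbf{p}}^+,\boldsymbol{\rho}_j)-\pi_j^{cons}(\tilde{\mathbf{p}}^+,\mathbf{y}_j^* )\bigr]+\sum_{i\in I}\bigl[\tilde\pi_i^{prod}(\tilde{\mathbf{p}}^+,\boldsymbol{\varepsilon}_i)-\pi_i^{prod}(\tilde{\mathbf{p}}^+,\mathbf{x}_i^* )\bigr]\le\sum_{j\in J}\bigl[\pi_j^{cons}(\mathbf{p}^+)-\pi_j^{cons}(\mathbf{p}^+,\mathbf{y}_j^*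 )\bigr]+\sum_{i\in I}\bigl[\pi_i^{prod}(\mathbf{p}^+)-\pi_i^{prod}(\mathbf{p}^+,\mathbf{x}_i^* )\bigr].$$
   Context: **Market.** There are $T$ time periods, a finite set $I=\{1,\dots,n\}$ of generating units and a finite set $J=\{1,\dots,m\}$ of consumers. Generator $i$ has a commitment vector $\mathbf{u}_i\in\{0,1\}^T$ and an output vector $\mathbf{g}_i\in\mathbb{R}_{\ge0}^T$; $\mathbf{x}_i=(\mathbf{u}_i,\mathbf{g}_i)$, $\mathbf{x}=(\mathbf{x}_1,\dots,\mathbf{x}_n)$. The individual feasible set $X_i\subset\{0,1\}^T\times\mathbb{R}_{\ge0}^T$ is compact. For each fixed $\mathbf{u}_i$ the cost $C_i(\mathbf{x}_i)$ is a non-negative continuous convex function of $\mathbf{g}_i$ on its domain (which may depend on $\mathbf{u}_i$ and contains all $\mathbf{g}_i$ with $(\mathbf{u}_i,\mathbf{g}_i)\in X_i$). Consumer $j$ has a consumption vector $\mathbf{d}_j\in\mathbb{R}_{\ge0}^T$. For $j$ in a subset $J^{nc}\subset J$ (non-convex demand) there is additionally a vector $\mathbf{v}_j$ of discrete variables (taking finitely many values), and $\mathbf{y}_j=(\mathbf{v}_j,\mathbf{d}_j)$; for $j\in J\setminus J^{nc}$, $\mathbf{y}_j=\mathbf{d}_j$. Put $\mathbf{y}=(\mathbf{y}_1,\dots,\mathbf{y}_m)$. The individual feasible set $Y_j$ of possible $\mathbf{y}_j$ is compact. The benefit function $B_j(\mathbf{y}_j)$ is, for each fixed $\mathbf{v}_j$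 (if any), a non-negative continuous concave function of $\mathbf{d}_j$ on its domain (which may depend on $\mathbf{v}_j$ and contains all $\mathbf{d}_j$ with $\mathbf{y}_j\in Y_j$). **Primal problem.** $U=\max\{\sum_{j\in J}B_j(\mathbf{y}_j)-\sum_{i\in I}C_i(\mathbf{x}_i):\mathbf{x}_i\in X_i\ \forall i\in I,\ \mathbf{y}_j\in Y_j\ \forall j\in J,\ \sum_{i\in I}\mathbf{g}_i=\sum_{j\in J}\mathbf{d}_j\}$; its feasible set $\Omega$ is assumed nonempty and compact. **Profits and dual.** For $\mathbf{p}\in\mathbb{R}^T$: $\pi_i^{prod}(\mathbf{p},\mathbf{x}_i)=\mathbf{p}^T\mathbf{g}_i-C_i(\mathbf{x}_i)$, $\pi_i^{prod}(\mathbf{p})=\max_{\mathbf{x}_i\in X_i}\pi_i^{prod}(\mathbf{p},\mathbf{x}_i)$, $\pi_j^{cons}(\mathbf{p},\mathbf{y}_j)=B_j(\mathbf{y}_j)-\mathbf{p}^T\mathbf{d}_j$, $\pi_j^{cons}(\mathbf{p})=\max_{\mathbf{y}_j\in Y_j}\pi_j^{cons}(\mathbf{p},\mathbf{y}_j)$. The dual value is $U^D=\inf_{\mathbf{p}\in\mathbb{R}^T}\bigl(\sum_{j\in J}\pi_j^{cons}(\mathbf{p})+\sum_{i\in I}\pi_i^{prod}(\mathbf{p})\bigr)$, with set of minimizers $P^+$. **Technologically and economically feasible points.** $\overline\Omega$ is the set of all $\{\overline{\mathbf{x}},\overline{\mathbf{y}}\}$ such that $\{\overline{\mathbf{x}},\overline{\mathbf{y}}\}$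 is itself a maximizer of $\sum_{j\in J}B_j(\mathbf{y}_j)-\sum_{i\in I}C_i(\mathbf{x}_i)$ over all $(\mathbf{x},\mathbf{y})$ with $\mathbf{x}_i\in X_i$ $\forall i\in I$, $\mathbf{y}_j\in Y_j$ $\forall j\in J$, $\sum_{i\in I}\mathbf{g}_i=\sum_{j\in J}\mathbf{d}_j$, $\mathbf{x}\le\overline{\mathbf{x}}$ and $\mathbf{y}\le\overline{\mathbf{y}}$ (componentwise inequalities). $\overline\Omega_i^{prod}$ and $\overline\Omega_j^{cons}$ are the projections of $\overline\Omega$ on $X_i$ and $Y_j$. **Modified individual feasible sets.** $C_i^{sunk}$, $B_j^{sunk}$ are given real constants (sunk cost and sunk benefit); $\Psi_i^{prod}=\{\mathbf{x}_i\in X_i:C_i(\mathbf{x}_i)=C_i^{sunk}\}$, $\Psi_j^{cons}=\{\mathbf{y}_j\in Y_j:B_j(\mathbf{y}_j)=B_j^{sunk}\}$. For $\boldsymbol{\varepsilon}_i,\boldsymbol{\rho}_j\in\mathbb{R}_{>0}^T$, $$\widetilde X_i(\boldsymbol{\varepsilon}_i)=\Psi_i^{prod}\cup\bigcup_{\overline{\mathbf{x}}_i\in\overline\Omega_i^{prod}}\{\mathbf{x}_i\in X_i:|g_i^t-\overline g_i^t|\le\varepsilon_i^t,\ t=1,\dots,T\},$$ $$\widetilde Y_j(\boldsymbol{\rho}_j)=\Psi_j^{cons}\cup\bigcup_{\overline{\mathbf{y}}_j\in\overline\Omega_j^{cons}}\{\mathbf{y}_j\in Y_j:|d_j^t-\overline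 d_j^t|\le\rho_j^t,\ t=1,\dots,T\}.$$ **Modified problems.** $\tilde U(\boldsymbol{\varepsilon},\boldsymbol{\rho})$ is the maximum of $\sum_{j\in J}B_j(\mathbf{y}_j)-\sum_{i\in I}C_i(\mathbf{x}_i)$ subject to $\mathbf{x}_i\in\widetilde X_i(\boldsymbol{\varepsilon}_i)$ $\forall i\in I$, $\mathbf{y}_j\in\widetilde Y_j(\boldsymbol{\rho}_j)$ $\forall j\in J$, $\sum_{i\in I}\mathbf{g}_i=\sum_{j\in J}\mathbf{d}_j$ (modified primal problem). Further $\tilde\pi_i^{prod}(\mathbf{p},\boldsymbol{\varepsilon}_i)=\sup_{\mathbf{x}_i\in\widetilde X_i(\boldsymbol{\varepsilon}_i)}\pi_i^{prod}(\mathbf{p},\mathbf{x}_i)$, $\tilde\pi_j^{cons}(\mathbf{p},\boldsymbol{\rho}_j)=\sup_{\mathbf{y}_j\in\widetilde Y_j(\boldsymbol{\rho}_j)}\pi_j^{cons}(\mathbf{p},\mathbf{y}_j)$, and $\tilde U^D(\boldsymbol{\varepsilon},\boldsymbol{\rho})=\inf_{\mathbf{p}\in\mathbb{R}^T}\bigl(\sum_{j\in J}\tilde\pi_j^{cons}(\mathbf{p},\boldsymbol{\rho}_j)+\sum_{i\in I}\tilde\pi_i^{prod}(\mathbf{p},\boldsymbol{\varepsilon}_i)\bigr)$, with set of minimizers $\tilde P^+(\boldsymbol{\varepsilon},\boldsymbol{\rho})$. *)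

theory Defs
  imports "HOL-Analysis.Analysis"
begin

text \<open>
  Time periods, generating units and consumers are the elements of the finite types 't, 'i, 'j.
  The dimension of the vector v of discrete variables depends on the consumer, so v is a sequence
  of reals vanishing from index \<open>ndisc M j\<close> on; a consumer without discrete variables
  has \<open>ndisc M j = 0\<close>, so that v is the zero sequence and carries no information.
  The order on all these types (functions, pairs and vectors) is componentwise, and the topology
  is the product topology.
\<close>

type_synonym 't gen_var = "(real ^ 't) \<times> (real ^ 't)"
type_synonym 't load_var = "(nat \<Rightarrow> real) \<times> (real ^ 't)"
type_synonym ('t, 'i, 'j) plan = "('i \<Rightarrow> 't gen_var) \<times> ('j \<Rightarrow> 't load_var)"

record ('t, 'i, 'j) market =
  gen_set :: "'i \<Rightarrow> ('t::finite) gen_var set"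
  cost_dom :: "'i \<Rightarrow> real ^ 't \<Rightarrow> (real ^ 't) set"
  cost :: "'i \<Rightarrow> 't gen_var \<Rightarrow> real"
  nonconvex_loads :: "'j set"
  ndisc :: "'j \<Rightarrow> nat"
  disc_vals :: "'j \<Rightarrow> (nat \<Rightarrow> real) set"
  load_set :: "'j \<Rightarrow> 't load_var set"
  benefit_dom :: "'j \<Rightarrow> (nat \<Rightarrow> real) \<Rightarrow> (real ^ 't) set"
  benefit :: "'j \<Rightarrow> 't load_var \<Rightarrow> real"
  sunk_cost :: "'i \<Rightarrow> real"
  sunk_benefit :: "'j \<Rightarrow> real"

definition binary_vecs :: "(real ^ 't::finite) set" where
  "binary_vecs = {u. \<forall>t. u $ t \<in> {0, 1}}"

definition nonneg_vecs :: "(real ^ 't::finite) set" where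
  "nonneg_vecs = {g. \<forall>t. 0 \<le> g $ t}"

definition balanced_plans ::
  "('i::finite \<Rightarrow> ('t::finite) gen_var set) \<Rightarrow> ('j::finite \<Rightarrow> 't load_var set) \<Rightarrow> ('t, 'i, 'j) plan set"
  where
  "balanced_plans A D = {(x, y). (\<forall>i. x i \<in> A i) \<and> (\<forall>j. y j \<in> D j) \<and>
      (\<Sum>i\<in>UNIV. snd (x i)) = (\<Sum>j\<in>UNIV. snd (y j))}"

definition primal_feasible ::
  "('t::finite, 'i::finite, 'j::finite) market \<Rightarrow> ('t, 'i, 'j) plan set" where
  "primal_feasible M = balanced_plans (gen_set M) (load_set M)"

definition is_market :: "('t::finite, 'i::finite, 'j::finite) market \<Rightarrow> bool" where
  "is_market M \<longleftrightarrow>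
     (\<forall>i. gen_set M i \<subseteq> binary_vecs \<times> nonneg_vecs \<and> compact (gen_set M i)) \<and>
     (\<forall>i. \<forall>u\<in>binary_vecs.
        {g. (u, g) \<in> gen_set M i} \<subseteq> cost_dom M i u \<and>
        (\<forall>g\<in>cost_dom M i u. 0 \<le> cost M i (u, g)) \<and>
        continuous_on (cost_dom M i u) (\<lambda>g. cost M i (u, g)) \<and>
        convex_on (cost_dom M i u) (\<lambda>g. cost M i (u, g))) \<and>
     (\<forall>j. j \<in> nonconvex_loads M \<longleftrightarrow> 0 < ndisc M j) \<and>
     (\<forall>j. finite (disc_vals M j) \<and> (\<forall>v\<in>disc_vals M j. \<forall>k\<ge>ndisc M j. v k = 0)) \<and>
     (\<forall>j. load_set M j \<subseteq> disc_vals M j \<times> nonneg_vecs \<and> compact (load_set M j)) \<and>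
     (\<forall>j. \<forall>v\<in>disc_vals M j.
        {d. (v, d) \<in> load_set M j} \<subseteq> benefit_dom M j v \<and>
        (\<forall>d\<in>benefit_dom M j v. 0 \<le> benefit M j (v, d)) \<and>
        continuous_on (benefit_dom M j v) (\<lambda>d. benefit M j (v, d)) \<and>
        concave_on (benefit_dom M j v) (\<lambda>d. benefit M j (v, d))) \<and>
     primal_feasible M \<noteq> {} \<and> compact (primal_feasible M)"

definition welfare ::
  "('t::finite, 'i::finite, 'j::finite) market \<Rightarrow> ('t, 'i, 'j) plan \<Rightarrow> real" where
  "welfare M z = (\<Sum>j\<in>UNIV. benefit M j (snd z j)) - (\<Sum>i\<in>UNIV. cost M i (fst z i))"

definition welfare_maximizers ::
  "('t::finite, 'i::finite, 'j::finite) market \<Rightarrow> ('t, 'i, 'j) plan set \<Rightarrow> ('t, 'i, 'j) plan set"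
  where
  "welfare_maximizers M F = {z \<in> F. \<forall>w\<in>F. welfare M w \<le> welfare M z}"

definition optimal_welfare ::
  "('t::finite, 'i::finite, 'j::finite) market \<Rightarrow> ('t, 'i, 'j) plan set \<Rightarrow> real" where
  "optimal_welfare M F = (SUP z\<in>F. welfare M z)"

definition profit_prod ::
  "('t::finite, 'i::finite, 'j::finite) market \<Rightarrow> 'i \<Rightarrow> real ^ 't \<Rightarrow> 't gen_var \<Rightarrow> real" where
  "profit_prod M i p xi = p \<bullet> snd xi - cost M i xi"

definition profit_cons ::
  "('t::finite, 'i::finite, 'j::finite) market \<Rightarrow> 'j \<Rightarrow> real ^ 't \<Rightarrow> 't load_var \<Rightarrow> real" where
  "profit_cons M j p yj = benefit M j yj - p \<bullet> snd yj"

definition best_profit_prod ::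
  "('t::finite, 'i::finite, 'j::finite) market \<Rightarrow> ('i \<Rightarrow> 't gen_var set) \<Rightarrow> 'i \<Rightarrow> real ^ 't \<Rightarrow> real"
  where
  "best_profit_prod M A i p = (SUP xi\<in>A i. profit_prod M i p xi)"

definition best_profit_cons ::
  "('t::finite, 'i::finite, 'j::finite) market \<Rightarrow> ('j \<Rightarrow> 't load_var set) \<Rightarrow> 'j \<Rightarrow> real ^ 't \<Rightarrow> real"
  where
  "best_profit_cons M D j p = (SUP yj\<in>D j. profit_cons M j p yj)"

definition dual_objective ::
  "('t::finite, 'i::finite, 'j::finite) market \<Rightarrow> ('i \<Rightarrow> 't gen_var set) \<Rightarrow>
     ('j \<Rightarrow> 't load_var set) \<Rightarrow> real ^ 't \<Rightarrow> real" where
  "dual_objective M A D p =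
     (\<Sum>j\<in>UNIV. best_profit_cons M D j p) + (\<Sum>i\<in>UNIV. best_profit_prod M A i p)"

definition dual_value ::
  "('t::finite, 'i::finite, 'j::finite) market \<Rightarrow> ('i \<Rightarrow> 't gen_var set) \<Rightarrow>
     ('j \<Rightarrow> 't load_var set) \<Rightarrow> real" where
  "dual_value M A D = (INF p. dual_objective M A D p)"

definition dual_minimizers ::
  "('t::finite, 'i::finite, 'j::finite) market \<Rightarrow> ('i \<Rightarrow> 't gen_var set) \<Rightarrow>
     ('j \<Rightarrow> 't load_var set) \<Rightarrow> (real ^ 't) set" where
  "dual_minimizers M A D = {p. \<forall>q. dual_objective M A D p \<le> dual_objective M A D q}"

definition tech_econ_feasible ::
  "('t::finite, 'i::finite, 'j::finite) market \<Rightarrow> ('t, 'i, 'j) plan set" where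
  "tech_econ_feasible M =
     {(xb, yb). (xb, yb) \<in>
        welfare_maximizers M {(x, y) \<in> primal_feasible M. x \<le> xb \<and> y \<le> yb}}"

definition tech_econ_prod ::
  "('t::finite, 'i::finite, 'j::finite) market \<Rightarrow> 'i \<Rightarrow> 't gen_var set" where
  "tech_econ_prod M i = (\<lambda>z. fst z i) ` tech_econ_feasible M"

definition tech_econ_cons ::
  "('t::finite, 'i::finite, 'j::finite) market \<Rightarrow> 'j \<Rightarrow> 't load_var set" where
  "tech_econ_cons M j = (\<lambda>z. snd z j) ` tech_econ_feasible M"

definition sunk_set_prod ::
  "('t::finite, 'i::finite, 'j::finite) market \<Rightarrow> 'i \<Rightarrow> 't gen_var set" where
  "sunk_set_prod M i = {xi \<in> gen_set M i. cost M i xi = sunk_cost M i}"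

definition sunk_set_cons ::
  "('t::finite, 'i::finite, 'j::finite) market \<Rightarrow> 'j \<Rightarrow> 't load_var set" where
  "sunk_set_cons M j = {yj \<in> load_set M j. benefit M j yj = sunk_benefit M j}"

definition mod_gen_set ::
  "('t::finite, 'i::finite, 'j::finite) market \<Rightarrow> ('i \<Rightarrow> real ^ 't) \<Rightarrow> 'i \<Rightarrow> 't gen_var set" where
  "mod_gen_set M \<epsilon> i = sunk_set_prod M i \<union>
     (\<Union>xb\<in>tech_econ_prod M i.
        {xi \<in> gen_set M i. \<forall>t. \<bar>snd xi $ t - snd xb $ t\<bar> \<le> \<epsilon> i $ t})"

definition mod_load_set ::
  "('t::finite, 'i::finite, 'j::finite) market \<Rightarrow> ('j \<Rightarrow> real ^ 't) \<Rightarrow> 'j \<Rightarrow> 't load_var set" where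
  "mod_load_set M \<rho> j = sunk_set_cons M j \<union>
     (\<Union>yb\<in>tech_econ_cons M j.
        {yj \<in> load_set M j. \<forall>t. \<bar>snd yj $ t - snd yb $ t\<bar> \<le> \<rho> j $ t})"

definition mod_feasible ::
  "('t::finite, 'i::finite, 'j::finite) market \<Rightarrow> ('i \<Rightarrow> real ^ 't) \<Rightarrow> ('j \<Rightarrow> real ^ 't) \<Rightarrow>
     ('t, 'i, 'j) plan set" where
  "mod_feasible M \<epsilon> \<rho> = balanced_plans (mod_gen_set M \<epsilon>) (mod_load_set M \<rho>)"

text \<open>
  The optimal values are real-valued suprema and infima. The following facts show that
  under \<^const>\<open>is_market\<close> the suprema written as maxima in the model are attained.
\<close>

lemma finite_binary_vecs: "finite (binary_vecs :: (real ^ 't::finite) set)"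
proof -
  have "finite (PiE (UNIV :: 't set) (\<lambda>_. {0, 1 :: real}))"
    by (intro finite_PiE) auto
  moreover have "binary_vecs \<subseteq> vec_lambda ` (PiE (UNIV :: 't set) (\<lambda>_. {0, 1 :: real}))"
  proof
    fix u :: "real ^ 't" assume "u \<in> binary_vecs"
    then have "vec_nth u \<in> PiE UNIV (\<lambda>_. {0, 1})" by (auto simp: binary_vecs_def)
    then show "u \<in> vec_lambda ` PiE UNIV (\<lambda>_. {0, 1})"
      by (metis image_eqI vec_nth_inverse)
  qed
  ultimately show ?thesis by (rule finite_surj)
qed

lemma continuous_on_finite_slices:
  fixes f :: "'a::t2_space \<times> 'b::t2_space \<Rightarrow> real"
  assumes "finite V" "S \<subseteq> V \<times> UNIV" "compact S"
    and cont: "\<And>v. v \<in> V \<Longrightarrow> continuous_on {d. (v, d) \<in> S} (\<lambda>d. f (v, d))"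
  shows "continuous_on S f"
proof -
  have S: "S = (\<Union>v\<in>V. S \<inter> ({v} \<times> UNIV))"
    using assms(2) by auto
  have "continuous_on (\<Union>v\<in>V. S \<inter> ({v} \<times> UNIV)) f"
  proof (rule continuous_on_closed_Union)
    fix v assume v: "v \<in> V"
    show "closed (S \<inter> ({v} \<times> UNIV))"
      using compact_imp_closed[OF assms(3)] by (intro closed_Int closed_Times) auto
    have "continuous_on (S \<inter> ({v} \<times> UNIV)) (\<lambda>z. f (v, snd z))"
      by (rule continuous_on_compose2[OF cont[OF v]]) (auto intro: continuous_intros)
    then show "continuous_on (S \<inter> ({v} \<times> UNIV)) f"
      by (rule continuous_on_eq) auto
  qed (use assms(1) in auto)
  then show ?thesis using S by simp
qed

lemma continuous_on_cost:
  assumes "is_market M" shows "continuous_on (gen_set M i) (cost M i)"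
proof (rule continuous_on_finite_slices[OF finite_binary_vecs])
  have "gen_set M i \<subseteq> binary_vecs \<times> nonneg_vecs"
    using assms unfolding is_market_def by blast
  then show "gen_set M i \<subseteq> binary_vecs \<times> UNIV" by blast
  show "compact (gen_set M i)"
    using assms unfolding is_market_def by blast
  show "continuous_on {g. (u, g) \<in> gen_set M i} (\<lambda>g. cost M i (u, g))"
    if "u \<in> binary_vecs" for u
  proof (rule continuous_on_subset)
    show "continuous_on (cost_dom M i u) (\<lambda>g. cost M i (u, g))"
      "{g. (u, g) \<in> gen_set M i} \<subseteq> cost_dom M i u"
      using assms that unfolding is_market_def by metis+
  qed
qed

lemma continuous_on_benefit:
  assumes "is_market M" shows "continuous_on (load_set M j) (benefit M j)"
proof (rule continuous_on_finite_slices)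
  have "load_set M j \<subseteq> disc_vals M j \<times> nonneg_vecs"
    using assms unfolding is_market_def by blast
  then show "load_set M j \<subseteq> disc_vals M j \<times> UNIV" by blast
  show "finite (disc_vals M j)" "compact (load_set M j)"
    using assms unfolding is_market_def by blast+
  show "continuous_on {d. (v, d) \<in> load_set M j} (\<lambda>d. benefit M j (v, d))"
    if "v \<in> disc_vals M j" for v
  proof (rule continuous_on_subset)
    show "continuous_on (benefit_dom M j v) (\<lambda>d. benefit M j (v, d))"
      "{d. (v, d) \<in> load_set M j} \<subseteq> benefit_dom M j v"
      using assms that unfolding is_market_def by metis+
  qed
qed

lemma best_profit_prod_attained:
  assumes "is_market M"
  obtains xi where "xi \<in> gen_set M i" "best_profit_prod M (gen_set M) i p = profit_prod M i p xi"
    "\<And>xi'. xi' \<in> gen_set M i \<Longrightarrow> profit_prod M i p xi' \<le> profit_prod M i p xi"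
proof -
  have "continuous_on (gen_set M i) (profit_prod M i p)"
    unfolding profit_prod_def by (intro continuous_intros continuous_on_cost assms)
  moreover have "compact (gen_set M i)" "primal_feasible M \<noteq> {}"
    using assms unfolding is_market_def by blast+
  moreover from this(2) have "gen_set M i \<noteq> {}"
    by (auto simp: primal_feasible_def balanced_plans_def)
  ultimately obtain xi where "xi \<in> gen_set M i"
      "\<forall>xi'\<in>gen_set M i. profit_prod M i p xi' \<le> profit_prod M i p xi"
    using continuous_attains_sup by blast
  then show thesis
    by (intro that) (auto simp: best_profit_prod_def intro!: cSup_eq_maximum)
qed

lemma best_profit_cons_attained:
  assumes "is_market M"
  obtains yj where "yj \<in> load_set M j" "best_profit_cons M (load_set M) j p = profit_cons M j p yj"
    "\<And>yj'. yj' \<in> load_set M j \<Longrightarrow> profit_cons M j p yj' \<le> profit_cons M j p yj"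
proof -
  have "continuous_on (load_set M j) (profit_cons M j p)"
    unfolding profit_cons_def by (intro continuous_intros continuous_on_benefit assms)
  moreover have "compact (load_set M j)" "primal_feasible M \<noteq> {}"
    using assms unfolding is_market_def by blast+
  moreover from this(2) have "load_set M j \<noteq> {}"
    by (auto simp: primal_feasible_def balanced_plans_def)
  ultimately obtain yj where "yj \<in> load_set M j"
      "\<forall>yj'\<in>load_set M j. profit_cons M j p yj' \<le> profit_cons M j p yj"
    using continuous_attains_sup by blast
  then show thesis
    by (intro that) (auto simp: best_profit_cons_def intro!: cSup_eq_maximum)
qed

lemma welfare_maximizers_nonempty:
  assumes "is_market M" shows "welfare_maximizers M (primal_feasible M) \<noteq> {}"
proof -
  have x: "fst z i \<in> gen_set M i" and y: "snd z j \<in> load_set M j"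
    if "z \<in> primal_feasible M" for z i j
    using that by (auto simp: primal_feasible_def balanced_plans_def)
  have cf: "continuous_on (primal_feasible M) (\<lambda>z. fst z i)" for i
    by (rule continuous_on_product_then_coordinatewise) (intro continuous_intros)
  have cs: "continuous_on (primal_feasible M) (\<lambda>z. snd z j)" for j
    by (rule continuous_on_product_then_coordinatewise) (intro continuous_intros)
  have "continuous_on (primal_feasible M) (welfare M)"
    unfolding welfare_def
    by (intro continuous_intros continuous_on_compose2[OF continuous_on_cost[OF assms] cf]
        continuous_on_compose2[OF continuous_on_benefit[OF assms] cs])
      (blast intro: x y)+
  moreover have "compact (primal_feasible M)" "primal_feasible M \<noteq> {}"
    using assms unfolding is_market_def by blast+
  ultimately obtain z where "z \<in> primal_feasible M"
      "\<forall>w\<in>primal_feasible M. welfare M w \<le> welfare M z"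
    using continuous_attains_sup by blast
  then have "z \<in> welfare_maximizers M (primal_feasible M)"
    by (simp add: welfare_maximizers_def)
  then show ?thesis by blast
qed

lemma optimal_welfare_eq:
  "z \<in> welfare_maximizers M F \<Longrightarrow> optimal_welfare M F = welfare M z"
  by (auto simp: welfare_maximizers_def optimal_welfare_def intro!: cSup_eq_maximum)

end

theory Submission
  imports Defs
begin

text \<open>
  A maximizer of welfare over all balanced plans is in particular a maximizer over the balanced
  plans lying componentwise below it, so it belongs to the technologically and economically
  feasible points (\<open>maximizer_tech_econ_feasible\<close>). Since every such point lies in
  its own neighbourhood, shrinking the individual feasible sets to the modified ones cuts
  balanced plans off but never an optimal one (\<open>maximizers_subset_mod_feasible\<close>).
  As optimal plans exist, maximizers and optimal value are unchanged
  (\<open>welfare_maximizers_restrict\<close>).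

  The dual objective at a fixed price is a sum of suprema over the individual feasible sets, so
  it can only decrease when these sets shrink (\<open>dual_objective_mono\<close>), and the dual
  value decreases with it. Weak duality (\<open>weak_duality\<close>) bounds the modified dual
  value below by the unchanged optimal welfare. Hence the duality gap does not grow and
  stays nonnegative. At a balanced plan payments of the consumers and revenues of the
  generators cancel, so the total uplift at a price is the dual objective minus the welfare of
  the plan (\<open>total_uplift_eq\<close>), and the comparison of uplifts reduces to that of the
  dual objectives.
\<close>

lemma balanced_plans_mono:
  assumes "\<And>i. A i \<subseteq> A' i" "\<And>j. D j \<subseteq> D' j"
  shows "balanced_plans A D \<subseteq> balanced_plans A' D'"
  using assms by (fastforce simp: balanced_plans_def)

text \<open>
  Existence of a maximizer over the larger set is essential: it is what forces a maximizer over
  the smaller set to reach the optimal value of the larger one.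
\<close>

lemma welfare_maximizers_restrict:
  assumes "F' \<subseteq> F" "welfare_maximizers M F \<subseteq> F'" "welfare_maximizers M F \<noteq> {}"
  shows "welfare_maximizers M F' = welfare_maximizers M F"
proof
  show "welfare_maximizers M F \<subseteq> welfare_maximizers M F'"
    using assms(1,2) by (auto simp: welfare_maximizers_def)
  obtain w where w: "w \<in> welfare_maximizers M F"
    using assms(3) by blast
  show "welfare_maximizers M F' \<subseteq> welfare_maximizers M F"
  proof
    fix z assume z: "z \<in> welfare_maximizers M F'"
    then have "z \<in> F" and wz: "welfare M w \<le> welfare M z"
      using w assms(1,2) by (auto simp: welfare_maximizers_def)
    moreover have "welfare M v \<le> welfare M z" if "v \<in> F" for v
      using w that wz by (fastforce simp: welfare_maximizers_def)
    ultimately show "z \<in> welfare_maximizers M F"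
      by (simp add: welfare_maximizers_def)
  qed
qed

lemma maximizer_tech_econ_feasible:
  assumes "z \<in> welfare_maximizers M (primal_feasible M)"
  shows "z \<in> tech_econ_feasible M"
  using assms by (cases z) (auto simp: tech_econ_feasible_def welfare_maximizers_def)

lemma mod_gen_set_subset: "mod_gen_set M \<epsilon> i \<subseteq> gen_set M i"
  by (auto simp: mod_gen_set_def sunk_set_prod_def)

lemma mod_load_set_subset: "mod_load_set M \<rho> j \<subseteq> load_set M j"
  by (auto simp: mod_load_set_def sunk_set_cons_def)

lemma tech_econ_prod_subset_mod:
  assumes "\<And>t. 0 \<le> \<epsilon> i $ t"
  shows "tech_econ_prod M i \<subseteq> mod_gen_set M \<epsilon> i"
proof
  fix xi assume xi: "xi \<in> tech_econ_prod M i"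
  then have "xi \<in> gen_set M i"
    by (auto simp: tech_econ_prod_def tech_econ_feasible_def welfare_maximizers_def
        primal_feasible_def balanced_plans_def)
  with xi assms show "xi \<in> mod_gen_set M \<epsilon> i"
    unfolding mod_gen_set_def by (intro UnI2 UN_I[of xi]) auto
qed

lemma tech_econ_cons_subset_mod:
  assumes "\<And>t. 0 \<le> \<rho> j $ t"
  shows "tech_econ_cons M j \<subseteq> mod_load_set M \<rho> j"
proof
  fix yj assume yj: "yj \<in> tech_econ_cons M j"
  then have "yj \<in> load_set M j"
    by (auto simp: tech_econ_cons_def tech_econ_feasible_def welfare_maximizers_def
        primal_feasible_def balanced_plans_def)
  with yj assms show "yj \<in> mod_load_set M \<rho> j"
    unfolding mod_load_set_def by (intro UnI2 UN_I[of yj]) auto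
qed

lemma maximizers_subset_mod_feasible:
  fixes M :: "('t::finite, 'i::finite, 'j::finite) market"
  assumes "\<And>i t. 0 \<le> \<epsilon> i $ t" "\<And>j t. 0 \<le> \<rho> j $ t"
  shows "welfare_maximizers M (primal_feasible M) \<subseteq> mod_feasible M \<epsilon> \<rho>"
proof
  fix z assume z: "z \<in> welfare_maximizers M (primal_feasible M)"
  have "fst z i \<in> mod_gen_set M \<epsilon> i" for i
    using tech_econ_prod_subset_mod[OF assms(1)] maximizer_tech_econ_feasible[OF z]
    by (fastforce simp: tech_econ_prod_def)
  moreover have "snd z j \<in> mod_load_set M \<rho> j" for j
    using tech_econ_cons_subset_mod[OF assms(2)] maximizer_tech_econ_feasible[OF z]
    by (fastforce simp: tech_econ_cons_def)
  ultimately show "z \<in> mod_feasible M \<epsilon> \<rho>"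
    using z by (auto simp: mod_feasible_def welfare_maximizers_def primal_feasible_def
        balanced_plans_def)
qed

lemma bdd_above_profit_prod:
  assumes "is_market M" "A i \<subseteq> gen_set M i"
  shows "bdd_above (profit_prod M i p ` A i)"
proof -
  obtain xi where "\<And>xi'. xi' \<in> gen_set M i \<Longrightarrow> profit_prod M i p xi' \<le> profit_prod M i p xi"
    using best_profit_prod_attained[OF assms(1)] by metis
  with assms(2) show ?thesis
    by (intro bdd_aboveI2[of _ _ "profit_prod M i p xi"]) blast
qed

lemma bdd_above_profit_cons:
  assumes "is_market M" "D j \<subseteq> load_set M j"
  shows "bdd_above (profit_cons M j p ` D j)"
proof -
  obtain yj where "\<And>yj'. yj' \<in> load_set M j \<Longrightarrow> profit_cons M j p yj' \<le> profit_cons M j p yj"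
    using best_profit_cons_attained[OF assms(1)] by metis
  with assms(2) show ?thesis
    by (intro bdd_aboveI2[of _ _ "profit_cons M j p yj"]) blast
qed

text \<open>
  Nonemptiness is needed because the supremum of the empty set is an unspecified real.
\<close>

lemma dual_objective_mono:
  fixes M :: "('t::finite, 'i::finite, 'j::finite) market"
  assumes "is_market M" "\<And>i. A i \<subseteq> gen_set M i" "\<And>j. D j \<subseteq> load_set M j"
    and "\<And>i. A i \<noteq> {}" "\<And>j. D j \<noteq> {}"
  shows "dual_objective M A D p \<le> dual_objective M (gen_set M) (load_set M) p"
  unfolding dual_objective_def best_profit_prod_def best_profit_cons_def
  by (intro add_mono sum_mono cSUP_subset_mono bdd_above_profit_prod bdd_above_profit_cons
      order.refl assms)

text \<open>
  The terms in \<open>p\<close> are the price times total consumption and the price times total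
  production.
\<close>

lemma sum_profits_eq_welfare:
  assumes "(x, y) \<in> balanced_plans A D"
  shows "(\<Sum>j\<in>UNIV. profit_cons M j p (y j)) + (\<Sum>i\<in>UNIV. profit_prod M i p (x i))
    = welfare M (x, y)"
proof -
  have "(\<Sum>i\<in>UNIV. p \<bullet> snd (x i)) = (\<Sum>j\<in>UNIV. p \<bullet> snd (y j))"
    using assms by (simp add: balanced_plans_def flip: inner_sum_right)
  then show ?thesis
    by (simp add: profit_prod_def profit_cons_def welfare_def sum_subtractf)
qed

lemma total_uplift_eq:
  assumes "(x, y) \<in> balanced_plans A' D'"
  shows "(\<Sum>j\<in>UNIV. best_profit_cons M D j p - profit_cons M j p (y j)) +
      (\<Sum>i\<in>UNIV. best_profit_prod M A i p - profit_prod M i p (x i))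
    = dual_objective M A D p - welfare M (x, y)"
  using sum_profits_eq_welfare[OF assms, of M p]
  by (simp add: dual_objective_def sum_subtractf)

text \<open>
  No participant earns more at an admissible plan than by its best response to the price, so the
  total uplift is nonnegative.
\<close>

lemma weak_duality:
  fixes M :: "('t::finite, 'i::finite, 'j::finite) market"
  assumes "is_market M" "\<And>i. A i \<subseteq> gen_set M i" "\<And>j. D j \<subseteq> load_set M j"
    and "z \<in> balanced_plans A D"
  shows "welfare M z \<le> dual_objective M A D p"
proof -
  obtain x y where z: "z = (x, y)" by (cases z)
  have xy: "(x, y) \<in> balanced_plans A D"
    using assms(4) z by simp
  have "profit_prod M i p (x i) \<le> best_profit_prod M A i p" for i
    unfolding best_profit_prod_def
    using xy by (intro cSUP_upper bdd_above_profit_prod assms) (auto simp: balanced_plans_def)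
  moreover have "profit_cons M j p (y j) \<le> best_profit_cons M D j p" for j
    unfolding best_profit_cons_def
    using xy by (intro cSUP_upper bdd_above_profit_cons assms) (auto simp: balanced_plans_def)
  ultimately have "0 \<le> (\<Sum>j\<in>UNIV. best_profit_cons M D j p - profit_cons M j p (y j)) +
      (\<Sum>i\<in>UNIV. best_profit_prod M A i p - profit_prod M i p (x i))"
    by (intro add_nonneg_nonneg sum_nonneg) simp_all
  then show ?thesis
    unfolding total_uplift_eq[OF xy] z by simp
qed

theorem mainTheorem2:
  fixes M :: "('t::finite, 'i::finite, 'j::finite) market"
    and \<epsilon> :: "'i \<Rightarrow> real ^ 't" and \<rho> :: "'j \<Rightarrow> real ^ 't"
  assumes "is_market M"
    and "\<forall>i t. 0 < \<epsilon> i $ t"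
    and "\<forall>j t. 0 < \<rho> j $ t"
  shows "welfare_maximizers M (primal_feasible M) = welfare_maximizers M (mod_feasible M \<epsilon> \<rho>)
    \<and> optimal_welfare M (primal_feasible M) = optimal_welfare M (mod_feasible M \<epsilon> \<rho>)
    \<and> 0 \<le> dual_value M (mod_gen_set M \<epsilon>) (mod_load_set M \<rho>) - optimal_welfare M (mod_feasible M \<epsilon> \<rho>)
    \<and> dual_value M (mod_gen_set M \<epsilon>) (mod_load_set M \<rho>) - optimal_welfare M (mod_feasible M \<epsilon> \<rho>)
        \<le> dual_value M (gen_set M) (load_set M) - optimal_welfare M (primal_feasible M)
    \<and> (\<forall>p \<in> dual_minimizers M (gen_set M) (load_set M).
       \<forall>p' \<in> dual_minimizers M (mod_gen_set M \<epsilon>) (mod_load_set M \<rho>).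
       \<forall>(x, y) \<in> welfare_maximizers M (primal_feasible M).
         (\<Sum>j\<in>UNIV. best_profit_cons M (mod_load_set M \<rho>) j p' - profit_cons M j p' (y j)) +
         (\<Sum>i\<in>UNIV. best_profit_prod M (mod_gen_set M \<epsilon>) i p' - profit_prod M i p' (x i))
         \<le> (\<Sum>j\<in>UNIV. best_profit_cons M (load_set M) j p - profit_cons M j p (y j)) +
           (\<Sum>i\<in>UNIV. best_profit_prod M (gen_set M) i p - profit_prod M i p (x i)))"
proof (intro conjI ballI)
  let ?A = "mod_gen_set M \<epsilon>" and ?D = "mod_load_set M \<rho>"
  let ?W = "welfare_maximizers M (primal_feasible M)"
  note A = mod_gen_set_subset[of M \<epsilon>] and D = mod_load_set_subset[of M \<rho>]
  have W_sub: "?W \<subseteq> mod_feasible M \<epsilon> \<rho>"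
    using assms(2,3) by (intro maximizers_subset_mod_feasible) (simp_all add: less_imp_le)
  have W_eq: "?W = welfare_maximizers M (mod_feasible M \<epsilon> \<rho>)"
    unfolding mod_feasible_def primal_feasible_def
    using W_sub welfare_maximizers_nonempty[OF assms(1)]
    by (intro welfare_maximizers_restrict[symmetric] balanced_plans_mono A D)
      (simp_all add: mod_feasible_def primal_feasible_def)
  then show "?W = welfare_maximizers M (mod_feasible M \<epsilon> \<rho>)" .
  obtain z where z: "z \<in> ?W"
    using welfare_maximizers_nonempty[OF assms(1)] by blast
  have opt: "optimal_welfare M (primal_feasible M) = welfare M z"
      "optimal_welfare M (mod_feasible M \<epsilon> \<rho>) = welfare M z"
    using z W_eq by (auto intro: optimal_welfare_eq)
  then show opt_eq: "optimal_welfare M (primal_feasible M) = optimal_welfare M (mod_feasible M \<epsilon> \<rho>)"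
    by simp
  have z_mod: "z \<in> balanced_plans ?A ?D"
    using z W_sub by (auto simp: mod_feasible_def)
  have weak: "welfare M z \<le> dual_objective M ?A ?D p" for p
    by (rule weak_duality[OF assms(1) A D z_mod])
  have nonempty: "?A i \<noteq> {}" "?D j \<noteq> {}" for i j
    using z_mod by (auto simp: balanced_plans_def)
  have mono: "dual_objective M ?A ?D p \<le> dual_objective M (gen_set M) (load_set M) p" for p
    by (rule dual_objective_mono[OF assms(1) A D nonempty])
  show "0 \<le> dual_value M ?A ?D - optimal_welfare M (mod_feasible M \<epsilon> \<rho>)"
    unfolding opt dual_value_def using weak by (simp add: cINF_greatest)
  have "dual_value M ?A ?D \<le> dual_value M (gen_set M) (load_set M)"
    unfolding dual_value_def
    using weak mono by (intro cINF_mono bdd_belowI2[of _ "welfare M z"]) auto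
  then show "dual_value M ?A ?D - optimal_welfare M (mod_feasible M \<epsilon> \<rho>)
      \<le> dual_value M (gen_set M) (load_set M) - optimal_welfare M (primal_feasible M)"
    using opt_eq by simp
  fix p p' w
  assume p': "p' \<in> dual_minimizers M ?A ?D" and w: "w \<in> ?W"
  obtain x y where xy: "w = (x, y)" by (cases w)
  have bal: "(x, y) \<in> balanced_plans (gen_set M) (load_set M)"
    using w xy by (simp add: welfare_maximizers_def primal_feasible_def)
  have "dual_objective M ?A ?D p' \<le> dual_objective M (gen_set M) (load_set M) p"
    using p' mono[of p] by (force simp: dual_minimizers_def intro: order_trans)
  then show "case w of (x, y) \<Rightarrow>
         (\<Sum>j\<in>UNIV. best_profit_cons M ?D j p' - profit_cons M j p' (y j)) +
         (\<Sum>i\<in>UNIV. best_profit_prod M ?A i p' - profit_prod M i p' (x i))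
         \<le> (\<Sum>j\<in>UNIV. best_profit_cons M (load_set M) j p - profit_cons M j p (y j)) +
           (\<Sum>i\<in>UNIV. best_profit_prod M (gen_set M) i p - profit_prod M i p (x i))"
    unfolding xy by (simp add: total_uplift_eq[OF bal])
qed

end
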